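(* Let $\mathbf A=\langle A,\wedge,\vee,\rightarrow,0,1\rangle$ be a connexive Heyting algebra and define $a\Rightarrow b:=a\rightarrow(a\wedge b)$ for $a,b\in A$. Then $\mathbb{H}(\mathbf A)=\langle A,\wedge,\vee,\Rightarrow,0,1\rangle$ is a Heyting algebra.
   Context: A connexive Heyting algebra is an algebra $\mathbf A=\langle A,\wedge,\vee,\rightarrow,0,1\rangle$ of type $\langle 2,2,2,0,0\rangle$ such that $\langle A,\wedge,\vee,0,1\rangle$ is a bounded distributive lattice with bottom $0$, top $1$ and lattice order $\le$, and, writing $\neg x:=x\rightarrow 0$, the following hold for all elements: (C1) $(x\rightarrow y)\rightarrow((y\rightarrow z)\rightarrow(x\rightarrow z))=1$; (C2) $(x\rightarrow y)\rightarrow\neg(x\rightarrow\neg y)=1$; (C3) $x\wedge(x\rightarrow y)=x\wedge y$; (C4) $x\rightarrow y\le(z\wedge x)\rightarrow(z\wedge y)$; (C5) $x\rightarrow y\le(z\vee x)\rightarrow(z\vee y)$. *)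

theory Defs
  imports "HOL-Algebra.Congruence"
begin

record 'a impl_algebra = "'a partial_object" +
  meet :: "'a \<Rightarrow> 'a \<Rightarrow> 'a" (infixl \<open>\<sqinter>\<index>\<close> 70)
  join :: "'a \<Rightarrow> 'a \<Rightarrow> 'a" (infixl \<open>\<squnion>\<index>\<close> 65)
  impl :: "'a \<Rightarrow> 'a \<Rightarrow> 'a" (infixr \<open>\<leadsto>\<index>\<close> 60)
  zero :: 'a (\<open>\<zero>\<index>\<close>)
  one :: 'a (\<open>\<one>\<index>\<close>)

definition le :: "('a, 'm) impl_algebra_scheme \<Rightarrow> 'a \<Rightarrow> 'a \<Rightarrow> bool" (infix \<open>\<sqsubseteq>\<index>\<close> 50)
  where "x \<sqsubseteq>\<^bsub>A\<^esub> y \<longleftrightarrow> x \<sqinter>\<^bsub>A\<^esub> y = x"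

definition neg :: "('a, 'm) impl_algebra_scheme \<Rightarrow> 'a \<Rightarrow> 'a" (\<open>\<sim>\<index> _\<close> [81] 80)
  where "\<sim>\<^bsub>A\<^esub> x = x \<leadsto>\<^bsub>A\<^esub> \<zero>\<^bsub>A\<^esub>"

text \<open>Algebras of type \<open>(2,2,2,0,0)\<close> whose reduct without the implication is a bounded
  distributive lattice; about the implication only closure is required.\<close>

locale bounded_distrib_lattice_impl =
  fixes A :: "('a, 'm) impl_algebra_scheme" (structure)
  assumes meet_closed: "\<lbrakk>x \<in> carrier A; y \<in> carrier A\<rbrakk> \<Longrightarrow> x \<sqinter> y \<in> carrier A"
    and join_closed: "\<lbrakk>x \<in> carrier A; y \<in> carrier A\<rbrakk> \<Longrightarrow> x \<squnion> y \<in> carrier A"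
    and impl_closed: "\<lbrakk>x \<in> carrier A; y \<in> carrier A\<rbrakk> \<Longrightarrow> x \<leadsto> y \<in> carrier A"
    and zero_closed: "\<zero> \<in> carrier A"
    and one_closed: "\<one> \<in> carrier A"
    and meet_comm: "\<lbrakk>x \<in> carrier A; y \<in> carrier A\<rbrakk> \<Longrightarrow> x \<sqinter> y = y \<sqinter> x"
    and join_comm: "\<lbrakk>x \<in> carrier A; y \<in> carrier A\<rbrakk> \<Longrightarrow> x \<squnion> y = y \<squnion> x"
    and meet_assoc: "\<lbrakk>x \<in> carrier A; y \<in> carrier A; z \<in> carrier A\<rbrakk>
      \<Longrightarrow> (x \<sqinter> y) \<sqinter> z = x \<sqinter> (y \<sqinter> z)"
    and join_assoc: "\<lbrakk>x \<in> carrier A; y \<in> carrier A; z \<in> carrier A\<rbrakk>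
      \<Longrightarrow> (x \<squnion> y) \<squnion> z = x \<squnion> (y \<squnion> z)"
    and meet_join_absorb: "\<lbrakk>x \<in> carrier A; y \<in> carrier A\<rbrakk> \<Longrightarrow> x \<sqinter> (x \<squnion> y) = x"
    and join_meet_absorb: "\<lbrakk>x \<in> carrier A; y \<in> carrier A\<rbrakk> \<Longrightarrow> x \<squnion> (x \<sqinter> y) = x"
    and meet_join_distrib: "\<lbrakk>x \<in> carrier A; y \<in> carrier A; z \<in> carrier A\<rbrakk>
      \<Longrightarrow> x \<sqinter> (y \<squnion> z) = (x \<sqinter> y) \<squnion> (x \<sqinter> z)"
    and zero_least: "x \<in> carrier A \<Longrightarrow> \<zero> \<sqsubseteq> x"
    and one_greatest: "x \<in> carrier A \<Longrightarrow> x \<sqsubseteq> \<one>"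

locale connexive_heyting_algebra = bounded_distrib_lattice_impl +
  assumes C1: "\<lbrakk>x \<in> carrier A; y \<in> carrier A; z \<in> carrier A\<rbrakk>
      \<Longrightarrow> (x \<leadsto> y) \<leadsto> ((y \<leadsto> z) \<leadsto> (x \<leadsto> z)) = \<one>"
    and C2: "\<lbrakk>x \<in> carrier A; y \<in> carrier A\<rbrakk>
      \<Longrightarrow> (x \<leadsto> y) \<leadsto> \<sim> (x \<leadsto> \<sim> y) = \<one>"
    and C3: "\<lbrakk>x \<in> carrier A; y \<in> carrier A\<rbrakk> \<Longrightarrow> x \<sqinter> (x \<leadsto> y) = x \<sqinter> y"
    and C4: "\<lbrakk>x \<in> carrier A; y \<in> carrier A; z \<in> carrier A\<rbrakk>
      \<Longrightarrow> x \<leadsto> y \<sqsubseteq> (z \<sqinter> x) \<leadsto> (z \<sqinter> y)"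
    and C5: "\<lbrakk>x \<in> carrier A; y \<in> carrier A; z \<in> carrier A\<rbrakk>
      \<Longrightarrow> x \<leadsto> y \<sqsubseteq> (z \<squnion> x) \<leadsto> (z \<squnion> y)"

locale heyting_algebra = bounded_distrib_lattice_impl +
  assumes residuation: "\<lbrakk>x \<in> carrier A; y \<in> carrier A; z \<in> carrier A\<rbrakk>
      \<Longrightarrow> x \<sqinter> y \<sqsubseteq> z \<longleftrightarrow> x \<sqsubseteq> y \<leadsto> z"

definition heyting_of :: "('a, 'm) impl_algebra_scheme \<Rightarrow> ('a, 'm) impl_algebra_scheme" (\<open>\<H>\<close>)
  where "\<H> A = A\<lparr>impl := \<lambda>a b. a \<leadsto>\<^bsub>A\<^esub> (a \<sqinter>\<^bsub>A\<^esub> b)\<rparr>"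

end

theory Submission
  imports Defs
begin

text \<open>By (C3), \<open>1 \<rightarrow> x = x\<close>, so (C4) gives \<open>x \<le> y \<rightarrow> (y \<and> x)\<close>. If \<open>x \<and> y \<le> z\<close>, then
  joining with \<open>y \<and> z\<close> through (C5) fixes the antecedent \<open>y\<close> and turns the consequent
  \<open>y \<and> x\<close> into \<open>y \<and> z\<close>, whence \<open>x \<le> y \<Rightarrow> z\<close>. The converse is modus ponens, i.e. (C3).\<close>

context bounded_distrib_lattice_impl
begin

lemma le_trans:
  assumes "x \<in> carrier A" "y \<in> carrier A" "z \<in> carrier A" "x \<sqsubseteq> y" "y \<sqsubseteq> z"
  shows "x \<sqsubseteq> z"
  using assms by (metis le_def meet_assoc)

lemma meet_le1:
  assumes "x \<in> carrier A" "y \<in> carrier A"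
  shows "x \<sqinter> y \<sqsubseteq> x"
  using assms by (metis join_comm join_meet_absorb le_def meet_closed meet_comm meet_join_absorb)

lemma meet_le2:
  assumes "x \<in> carrier A" "y \<in> carrier A"
  shows "x \<sqinter> y \<sqsubseteq> y"
  using assms by (metis meet_comm meet_le1)

lemma le_meet:
  assumes "x \<in> carrier A" "y \<in> carrier A" "z \<in> carrier A" "x \<sqsubseteq> y" "x \<sqsubseteq> z"
  shows "x \<sqsubseteq> y \<sqinter> z"
  using assms by (metis le_def meet_assoc)

lemma meet_left_mono:
  assumes "x \<in> carrier A" "y \<in> carrier A" "z \<in> carrier A" "x \<sqsubseteq> y"
  shows "z \<sqinter> x \<sqsubseteq> z \<sqinter> y"
  using assms by (meson le_meet le_trans meet_closed meet_le1 meet_le2)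

lemma join_absorb_le:
  assumes "x \<in> carrier A" "y \<in> carrier A" "x \<sqsubseteq> y"
  shows "x \<squnion> y = y" "y \<squnion> x = y"
  using assms by (metis join_comm join_meet_absorb le_def meet_comm)+

lemma one_meet:
  assumes "x \<in> carrier A"
  shows "\<one> \<sqinter> x = x" "x \<sqinter> \<one> = x"
  using assms by (metis le_def meet_comm one_closed one_greatest)+

end

context connexive_heyting_algebra
begin

lemma one_impl:
  assumes "x \<in> carrier A"
  shows "\<one> \<leadsto> x = x"
  using assms by (metis C3 impl_closed one_closed one_meet(1))

text \<open>The instance of \<open>C4\<close> starts from \<open>\<one> \<leadsto> x\<close>, which
  is \<open>x\<close>; meeting with \<open>y\<close> turns the antecedent \<open>\<one>\<close> into
  \<open>y\<close>.\<close>

lemma le_impl_meet: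
  assumes "x \<in> carrier A" "y \<in> carrier A"
  shows "x \<sqsubseteq> y \<leadsto> (y \<sqinter> x)"
  using assms C4[of \<one> x y] by (simp add: one_impl one_meet one_closed)

text \<open>Joining with \<open>b\<close> in \<open>C5\<close> leaves the antecedent
  \<open>y\<close> fixed because \<open>b\<close> lies below it, and raises the consequent
  \<open>a\<close> to \<open>b\<close>.\<close>

lemma impl_mono_below:
  assumes "a \<in> carrier A" "b \<in> carrier A" "y \<in> carrier A" "a \<sqsubseteq> b" "b \<sqsubseteq> y"
  shows "y \<leadsto> a \<sqsubseteq> y \<leadsto> b"
  using assms C5[of y a b] by (simp add: join_absorb_le)

lemma residuation_impl_meet:
  assumes "x \<in> carrier A" "y \<in> carrier A" "z \<in> carrier A"
  shows "x \<sqinter> y \<sqsubseteq> z \<longleftrightarrow> x \<sqsubseteq> y \<leadsto> (y \<sqinter> z)"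
proof
  assume "x \<sqinter> y \<sqsubseteq> z"
  \<comment> \<open>Meeting both sides with \<open>y\<close> puts the consequents below the
    antecedent, as \<open>impl_mono_below\<close> demands.\<close>
  then have "y \<sqinter> x \<sqsubseteq> y \<sqinter> z"
    using assms by (metis le_meet meet_closed meet_comm meet_le1)
  then have "y \<leadsto> (y \<sqinter> x) \<sqsubseteq> y \<leadsto> (y \<sqinter> z)"
    using assms by (simp add: impl_mono_below meet_closed meet_le1)
  then show "x \<sqsubseteq> y \<leadsto> (y \<sqinter> z)"
    using assms le_impl_meet le_trans by (meson impl_closed meet_closed)
next
  assume "x \<sqsubseteq> y \<leadsto> (y \<sqinter> z)"
  \<comment> \<open>Meeting with \<open>y\<close> produces the left side of
    \<open>C3\<close>.\<close>
  then have "y \<sqinter> x \<sqsubseteq> y \<sqinter> (y \<leadsto> (y \<sqinter> z))"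
    using assms by (simp add: impl_closed meet_closed meet_left_mono)
  also have "y \<sqinter> (y \<leadsto> (y \<sqinter> z)) = y \<sqinter> (y \<sqinter> z)"
    using assms by (simp add: C3 meet_closed)
  finally show "x \<sqinter> y \<sqsubseteq> z"
    using assms by (metis le_trans meet_closed meet_comm meet_le2)
qed

end

theorem theorem3p13:
  fixes A :: "('a, 'm) impl_algebra_scheme" (structure)
  assumes "connexive_heyting_algebra A"
  shows "heyting_algebra (\<H> A)"
proof -
  interpret connexive_heyting_algebra A by fact
  \<comment> \<open>The order is defined from the meet, which \<open>heyting_of\<close> leaves
    untouched.\<close>
  have le_eq: "x \<sqsubseteq>\<^bsub>\<H> A\<^esub> y \<longleftrightarrow> x \<sqsubseteq> y" for x y
    by (simp add: le_def heyting_of_def)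
  \<comment> \<open>Only closure and residuation involve the new implication; the lattice and bound
    laws carry over from \<open>A\<close>.\<close>
  show ?thesis
    by (unfold_locales, unfold le_eq)
      (simp_all add: heyting_of_def meet_closed join_closed impl_closed zero_closed one_closed
        meet_assoc join_assoc meet_join_absorb join_meet_absorb meet_join_distrib
        zero_least one_greatest residuation_impl_meet, auto intro: meet_comm join_comm)
qed

end
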